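(* Let $H$ be an induced subgraph of a strongly regular graph $G$ belonging to the family $\mathrm{srg}(n,d,\lambda,\mu)$, and let $t = \sqrt{(\lambda-\mu)^2+4(d-\mu)}$. Then the following hold. (1) $$\vartheta(H) \leq \frac{n\,(t+\mu-\lambda)}{2d+t+\mu-\lambda}, \qquad \mathcal{E}(H) \leq d\,\biggl(1+\frac{2(n-d)+\lambda-\mu}{t}\biggr).$$ (2) Specifically, if $H$ is a strongly regular graph in the family $\mathrm{srg}(n',d',\lambda',\mu')$, where $n'\leq n$, $d'\leq d$, $\lambda'\leq\lambda$ and $\mu'\leq\mu$, then, with $t' = \sqrt{(\lambda'-\mu')^2+4(d'-\mu')}$, $$\frac{n'}{n}\cdot\frac{t'+\mu'-\lambda'}{t+\mu-\lambda}\cdot\frac{2d+t+\mu-\lambda}{2d'+t'+\mu'-\lambda'} \leq 1, \qquad \frac{t\,d'}{t'\,d}\cdot\frac{t'+2(n'-d')+\lambda'-\mu'}{t+2(n-d)+\lambda-\mu}\leq 1.$$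
   Context: All graphs are finite, simple and undirected, with nonempty vertex set. A $d$-regular graph on $n$ vertices is strongly regular, in the family $\mathrm{srg}(n,d,\lambda,\mu)$ with $\lambda,\mu$ nonnegative integers, if every pair of adjacent vertices has exactly $\lambda$ common neighbors and every pair of distinct nonadjacent vertices has exactly $\mu$ common neighbors. Complete graphs and empty (edgeless) graphs are excluded from the strongly regular graphs; disconnected graphs (with $\mu=0$) are allowed. An induced subgraph of $G$ is obtained by deleting vertices of $G$ along with all their incident edges. An orthonormal representation of a graph $G$ in $\mathbb{R}^m$ assigns to each vertex $i$ a unit vector $\mathbf{u}_i\in\mathbb{R}^m$ such that $\mathbf{u}_i^{\mathrm{T}}\mathbf{u}_j=0$ for every two distinct nonadjacent vertices $i,j$. The Lovász $\vartheta$-function of $G$ is $$\vartheta(G) = \min_{\{\mathbf{u}_i\},\,\mathbf{c}}\ \max_{i\in V(G)} \frac{1}{(\mathbf{c}^{\mathrm{T}}\mathbf{u}_i)^2},$$ the minimum being over all orthonormal representations $\{\mathbf{u}_i\}$ of $G$ and all unit vectors $\mathbf{c}$ of the same dimension (with $1/0=+\infty$; the dimension can be taken to be $|V(G)|$). The energy $\mathcal{E}(G)$ is the sum of the absolute values of the eigenvalues, counted with multiplicity, of the adjacency matrix of $G$. *)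

theory Defs
  imports
    "HOL-Library.Extended_Real"
    "Graph_Theory.Graph_Theory"
    "Jordan_Normal_Form.Char_Poly"
begin

text \<open>
  Finite simple undirected graphs are modelled by the locale \<open>graph\<close> of the Graph_Theory library:
  finite symmetric digraphs without loops and parallel arcs, an undirected edge being a pair of
  opposite arcs.
\<close>

definition common_neighbors :: "('a, 'b) pre_digraph \<Rightarrow> 'a \<Rightarrow> 'a \<Rightarrow> 'a set" where
  "common_neighbors G u v = {w \<in> verts G. u \<rightarrow>\<^bsub>G\<^esub> w \<and> v \<rightarrow>\<^bsub>G\<^esub> w}"

text \<open>
  Complete and edgeless graphs are excluded (in particular the vertex set is nonempty);
  disconnected graphs are not.
\<close>

definition strongly_regular ::
  "('a, 'b) pre_digraph \<Rightarrow> nat \<Rightarrow> nat \<Rightarrow> nat \<Rightarrow> nat \<Rightarrow> bool" where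
  "strongly_regular G n d l m \<longleftrightarrow>
     graph G \<and> card (verts G) = n \<and>
     (\<forall>v\<in>verts G. out_degree G v = d) \<and>
     (\<forall>u\<in>verts G. \<forall>v\<in>verts G. u \<rightarrow>\<^bsub>G\<^esub> v \<longrightarrow> card (common_neighbors G u v) = l) \<and>
     (\<forall>u\<in>verts G. \<forall>v\<in>verts G. u \<noteq> v \<and> \<not> u \<rightarrow>\<^bsub>G\<^esub> v \<longrightarrow> card (common_neighbors G u v) = m) \<and>
     \<not> complete_digraph n G \<and> arcs G \<noteq> {}"

definition orthonormal_rep :: "('a, 'b) pre_digraph \<Rightarrow> nat \<Rightarrow> ('a \<Rightarrow> real vec) \<Rightarrow> bool" where
  "orthonormal_rep G k u \<longleftrightarrow>
     (\<forall>i\<in>verts G. u i \<in> carrier_vec k \<and> u i \<bullet> u i = 1) \<and>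
     (\<forall>i\<in>verts G. \<forall>j\<in>verts G. i \<noteq> j \<and> \<not> i \<rightarrow>\<^bsub>G\<^esub> j \<longrightarrow> u i \<bullet> u j = 0)"

text \<open>
  The dimension \<open>k\<close> ranges over all natural numbers, and the minimum is written as an infimum.
  In the extended reals \<open>1 / 0 = \<infinity>\<close>, as the definition requires.
\<close>

definition lovasz_theta :: "('a, 'b) pre_digraph \<Rightarrow> ereal" where
  "lovasz_theta G =
     Inf {Max ((\<lambda>i. 1 / ereal ((c \<bullet> u i)\<^sup>2)) ` verts G) | k u c.
            orthonormal_rep G k u \<and> c \<in> carrier_vec k \<and> c \<bullet> c = 1}"

text \<open>
  The vertices are listed in an arbitrary order; another order conjugates the adjacency matrix by a
  permutation matrix and leaves its characteristic polynomial unchanged.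
\<close>

definition vertex_list :: "('a, 'b) pre_digraph \<Rightarrow> 'a list" where
  "vertex_list G = (SOME vs. distinct vs \<and> set vs = verts G)"

definition adjacency_matrix :: "('a, 'b) pre_digraph \<Rightarrow> real mat" where
  "adjacency_matrix G =
     (let vs = vertex_list G
      in mat (length vs) (length vs) (\<lambda>(i, j). if vs ! i \<rightarrow>\<^bsub>G\<^esub> vs ! j then 1 else 0))"

text \<open>
  The adjacency matrix of an undirected graph is real symmetric, so all its eigenvalues are real.
  The multiplicity of an eigenvalue is its order as a root of the characteristic polynomial.
\<close>

definition energy :: "('a, 'b) pre_digraph \<Rightarrow> real" where
  "energy G =
     (\<Sum>x | eigenvalue (adjacency_matrix G) x.
        real (Polynomial.order x (char_poly (adjacency_matrix G))) * \<bar>x\<bar>)"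

end

theory Submission
  imports Defs
begin

text \<open>
  The adjacency matrix \<open>A\<close> of a strongly regular graph satisfies \<open>(A - r) (A - s) = \<mu> J\<close>, where \<open>J\<close> is the
  all-ones matrix and \<open>r - s = t\<close>. The orthogonal projections \<open>E\<^sub>r\<close> and \<open>E\<^sub>s\<close> onto the eigenspaces are
  therefore explicit combinations of \<open>A\<close>, the identity and \<open>J\<close>, with
  \<open>A = (d / n) J + r E\<^sub>r + s E\<^sub>s\<close>. Every matrix function of \<open>A\<close> can be written down, and all claims about
  strongly regular graphs become inequalities for quadratic forms tested on suitable vectors.

  For the theta function, the square root of \<open>1 - A / s\<close> has columns that form an orthonormal
  representation of the graph, and all of them have the same inner product with the normalized
  all-ones vector. Keeping the columns of the vertices of \<open>H\<close> gives a representation of \<open>H\<close>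
  (\<open>lovasz_theta_le\<close>).

  For the energy, \<open>\<bar>A\<bar> = A - 2 s E\<^sub>s\<close> has a constant diagonal entry \<open>e\<close>, and \<open>n e\<close> is the claimed bound.
  The forms satisfy \<open>\<bar>w\<^sup>T A w\<bar> \<le> w\<^sup>T \<bar>A\<bar> w\<close>, in particular for vectors supported on \<open>H\<close>. Adding this over an
  orthonormal basis of the vectors supported on \<open>H\<close>, or over any Parseval frame, bounds the sum of
  \<open>\<bar>w\<^sup>T A w\<bar>\<close> by \<open>e\<close> times the number of vertices of \<open>H\<close> (\<open>sum_abs_frame_le\<close>). A basis that triangularizes the
  adjacency matrix of \<open>H\<close> turns the left-hand side into an upper bound for the energy of \<open>H\<close>
  (\<open>root_abs_sum_char_poly_le\<close>).

  For the second part, the same inequalities for the larger graph are tested on vectors built from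
  the smaller one. The energy inequality comes from the frame of the columns of \<open>E'\<^sub>s\<close> and \<open>1 - E'\<^sub>s\<close>
  (\<open>mean_energy_mono\<close>), and the inequality for the theta function from the indicator vector of \<open>H\<close>
  and a column of \<open>E'\<^sub>s\<close> (\<open>ratio_bound\<close>).
\<close>

section \<open>Roots of characteristic polynomials and orthogonal matrices\<close>

text \<open>
  The energy depends on the adjacency matrix only through its characteristic polynomial, and this
  is the dependence.
\<close>

definition root_abs_sum :: "real poly \<Rightarrow> real" where
  "root_abs_sum p = (\<Sum>x | poly p x = 0. real (Polynomial.order x p) * \<bar>x\<bar>)"

lemma root_abs_sum_linear_times:
  assumes "q \<noteq> 0"
  shows "root_abs_sum ([:- e, 1:] * q) = \<bar>e\<bar> + root_abs_sum q"
proof -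
  let ?p = "[:- e, 1:] * q"
  define R where "R = insert e {x. poly q x = 0}"
  have p0: "?p \<noteq> 0" using assms by (metis mult_eq_0_iff one_neq_zero pCons_eq_0_iff)
  have fin: "finite R" using poly_roots_finite[OF assms] by (simp add: R_def)
  have ord: "Polynomial.order x ?p = (if x = e then 1 else 0) + Polynomial.order x q" for x
    using order_mult[OF p0, of x] order_power_n_n[of e 1]
    by (auto simp: order_0I)
  have roots: "{x. poly ?p x = 0} = R" by (auto simp: R_def)
  have "root_abs_sum ?p = (\<Sum>x\<in>R. (if x = e then \<bar>x\<bar> else 0) + real (Polynomial.order x q) * \<bar>x\<bar>)"
    unfolding root_abs_sum_def roots ord by (intro sum.cong) (auto simp: algebra_simps)
  also have "\<dots> = \<bar>e\<bar> + (\<Sum>x\<in>R. real (Polynomial.order x q) * \<bar>x\<bar>)"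
    using fin by (simp add: sum.distrib sum.delta R_def)
  also have "(\<Sum>x\<in>R. real (Polynomial.order x q) * \<bar>x\<bar>) = root_abs_sum q"
    unfolding root_abs_sum_def
    by (rule sum.mono_neutral_right[OF fin]) (auto simp: R_def order_0I)
  finally show ?thesis .
qed

text \<open>
  The matrix is the Householder reflection that swaps \<open>v\<close> and the first unit vector. Its formula
  divides by \<open>1 - v $ 0\<close>, and the sign condition on \<open>v $ 0\<close> keeps this away from zero.
\<close>

lemma orthogonal_matrix_with_first_column:
  fixes v :: "real vec"
  assumes v: "v \<in> carrier_vec n" and unit: "v \<bullet> v = 1" and n: "n > 0" and neg: "v $ 0 \<le> 0"
  shows "\<exists>W \<in> carrier_mat n n. W\<^sup>T * W = 1\<^sub>m n \<and> col W 0 = v"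
proof -
  define u where "u i = v $ i - of_bool (i = 0)" for i
  define c where "c = 1 / (1 - v $ 0)"
  define W where "W = mat n n (\<lambda>(i, j). of_bool (i = j) - c * u i * u j)"
  have W: "W \<in> carrier_mat n n" by (simp add: W_def)
  have unit': "(\<Sum>k<n. v $ k * v $ k) = 1"
    using unit v by (simp add: scalar_prod_def lessThan_atLeast0)
  have "(\<Sum>k<n. u k * u k) = (\<Sum>k<n. v $ k * v $ k + of_bool (k = 0) * (1 - 2 * v $ k))"
    by (intro sum.cong) (auto simp: u_def algebra_simps)
  also have "\<dots> = 2 * (1 - v $ 0)"
    using n unit' by (simp add: sum.distrib of_bool_def if_distrib[of "\<lambda>x. x * _"] cong: if_cong)
  finally have c: "c * (\<Sum>k<n. u k * u k) = 2" using neg by (simp add: c_def divide_eq_eq algebra_simps)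
  have WW: "(\<Sum>k<n. W $$ (k, i) * W $$ (k, j)) = of_bool (i = j)" if "i < n" "j < n" for i j
  proof -
    have "(\<Sum>k<n. W $$ (k, i) * W $$ (k, j)) =
      (\<Sum>k<n. (if k = i then of_bool (k = j) - c * u k * u j else 0) - (if k = j then c * u k * u i else 0)
           + c * u i * u j * (c * (u k * u k)))"
      using that by (intro sum.cong) (auto simp: W_def algebra_simps)
    also have "\<dots> = of_bool (i = j) - c * u i * u j - c * u j * u i + c * u i * u j * (c * (\<Sum>k<n. u k * u k))"
      using that by (simp add: sum.distrib sum_subtractf sum_distrib_left)
    also have "\<dots> = of_bool (i = j)" unfolding c by simp
    finally show ?thesis .
  qed
  have "W\<^sup>T * W = 1\<^sub>m n"
    using W WW by (intro eq_matI) (auto simp: scalar_prod_def lessThan_atLeast0)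
  moreover have "col W 0 = v"
  proof (rule eq_vecI)
    fix i assume "i < dim_vec v"
    then have i: "i < n" using v by simp
    have "c * u 0 = -1" using neg by (simp add: c_def u_def field_simps)
    then have "c * u i * u 0 = - u i" by (metis mult.commute mult.left_commute mult_minus1)
    then show "col W 0 $ i = v $ i" using i n by (simp add: W_def u_def)
  qed (use v W in simp)
  ultimately show ?thesis using W by blast
qed

lemma unit_eigenvector_nonpos_first:
  fixes A :: "real mat"
  assumes A: "A \<in> carrier_mat n n" and ev: "eigenvalue A e"
  obtains v where "v \<in> carrier_vec n" "v \<bullet> v = 1" "v $ 0 \<le> 0" "A *\<^sub>v v = e \<cdot>\<^sub>v v"
proof -
  obtain x where x: "x \<in> carrier_vec n" "x \<noteq> 0\<^sub>v n" "A *\<^sub>v x = e \<cdot>\<^sub>v x"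
    using ev A unfolding eigenvalue_def eigenvector_def by auto
  have n: "n > 0" using x(1,2) by (cases n) auto
  have pos: "x \<bullet> x > 0"
  proof -
    obtain i where i: "i < n" "x $ i \<noteq> 0" using x(1,2) by (metis carrier_vecD eq_vecI index_zero_vec)
    have "0 < (\<Sum>k\<in>{0..<n}. x $ k * x $ k)"
      using i by (intro sum_pos2[of _ i]) (auto simp: zero_less_mult_iff linorder_neq_iff)
    then show ?thesis using x(1) by (simp add: scalar_prod_def)
  qed
  define c where "c = (if x $ 0 \<le> 0 then 1 else -1) / sqrt (x \<bullet> x)"
  have c2: "c * c * (x \<bullet> x) = 1" using pos by (simp add: c_def)
  have "(c \<cdot>\<^sub>v x) \<bullet> (c \<cdot>\<^sub>v x) = 1" using c2 x(1) by simp
  moreover have "(c \<cdot>\<^sub>v x) $ 0 \<le> 0"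
    using n x(1) pos by (auto simp: c_def mult_le_0_iff divide_nonpos_pos)
  moreover have "A *\<^sub>v (c \<cdot>\<^sub>v x) = e \<cdot>\<^sub>v (c \<cdot>\<^sub>v x)"
    using x A by (simp add: mult_mat_vec smult_smult_assoc mult.commute)
  ultimately show ?thesis using that[of "c \<cdot>\<^sub>v x"] x(1) by simp
qed

text \<open>
  This is a Schur triangularization that splits off real eigenvalues one at a time and stops when
  none is left. The roots split off are diagonal entries of \<open>W\<^sup>T A W\<close>; the block that remains has no
  real root, and its diagonal entries can only increase the right-hand side.
\<close>

lemma root_abs_sum_char_poly_le:
  fixes A :: "real mat"
  assumes "A \<in> carrier_mat n n"
  shows "\<exists>W \<in> carrier_mat n n. W\<^sup>T * W = 1\<^sub>m n \<and>
           root_abs_sum (char_poly A) \<le> (\<Sum>i<n. \<bar>(W\<^sup>T * (A * W)) $$ (i, i)\<bar>)"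
  using assms
proof (induction n arbitrary: A)
  case 0
  then have "degree (char_poly A) = 0 \<and> coeff (char_poly A) 0 = 1"
    using degree_monic_char_poly[of A 0] by auto
  then have "char_poly A = 1" by (metis degree_eq_zeroE coeff_pCons_0 one_pCons)
  then have "root_abs_sum (char_poly A) = 0" by (simp add: root_abs_sum_def)
  then show ?case by (intro bexI[of _ "1\<^sub>m 0"]) auto
next
  case (Suc n A)
  note A = Suc.prems
  show ?case
  proof (cases "\<exists>e. eigenvalue A e")
    case False
    then have "{x. poly (char_poly A) x = 0} = {}"
      using eigenvalue_root_char_poly[OF A] by auto
    then have "root_abs_sum (char_poly A) = 0" unfolding root_abs_sum_def by (simp only: sum.empty)
    then show ?thesis
      by (intro bexI[of _ "1\<^sub>m (Suc n)"]) (auto intro: sum_nonneg)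
  next
    case True
    then obtain e where e: "eigenvalue A e" ..
    obtain v where v: "v \<in> carrier_vec (Suc n)" "v \<bullet> v = 1" "v $ 0 \<le> 0" "A *\<^sub>v v = e \<cdot>\<^sub>v v"
      using unit_eigenvector_nonpos_first[OF A e] .
    obtain W where W: "W \<in> carrier_mat (Suc n) (Suc n)" "W\<^sup>T * W = 1\<^sub>m (Suc n)" "col W 0 = v"
      using orthogonal_matrix_with_first_column[OF v(1,2) _ v(3)] by auto
    have WT: "W\<^sup>T \<in> carrier_mat (Suc n) (Suc n)" using W by simp
    have WWT: "W * W\<^sup>T = 1\<^sub>m (Suc n)" using mat_mult_left_right_inverse[OF WT W(1,2)] .
    \<comment> \<open>The first column of \<open>B\<close> is \<open>e\<close> times a unit vector, so \<open>B\<close> is block triangular with corner \<open>e\<close>.\<close>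
    define B where "B = W\<^sup>T * (A * W)"
    have B: "B \<in> carrier_mat (Suc n) (Suc n)" using A W by (simp add: B_def)
    have "col B 0 = W\<^sup>T *\<^sub>v (A *\<^sub>v col W 0)"
      unfolding B_def using col_mult2[OF WT mult_carrier_mat[OF A W(1)]] col_mult2[OF A W(1)] by simp
    also have "\<dots> = e \<cdot>\<^sub>v (W\<^sup>T *\<^sub>v col W 0)"
      unfolding W(3) v(4) using WT v(1) by (simp add: mult_mat_vec)
    also have "W\<^sup>T *\<^sub>v col W 0 = col (W\<^sup>T * W) 0"
      using col_mult2[OF WT W(1)] by simp
    finally have colB: "col B 0 = e \<cdot>\<^sub>v unit_vec (Suc n) 0" unfolding W(2) by simp
    have B0: "B $$ (i, 0) = (if i = 0 then e else 0)" if "i < Suc n" for i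
      using arg_cong[OF colB, of "\<lambda>x. x $ i"] that B by (auto simp: unit_vec_def)
    obtain B1 B2 B3 B4 where split: "split_block B 1 1 = (B1, B2, B3, B4)"
      using prod_cases4 by blast
    from B have dims: "dim_row B = 1 + n" "dim_col B = 1 + n" by auto
    note sb = split_block[OF split dims]
    have B1: "B1 = mat 1 1 (\<lambda>_. e)" and B3: "B3 = 0\<^sub>m n 1"
      using split B B0 unfolding split_block_def Let_def by (auto intro!: eq_matI)
    have "similar_mat_wit B A (W\<^sup>T) W"
      by (rule similar_mat_witI[of _ _ "Suc n"]) (use A B W WT WWT in \<open>auto simp: B_def assoc_mult_mat[of _ "Suc n" "Suc n" _ "Suc n" _ "Suc n"]\<close>)
    then have "char_poly A = char_poly B"
      using char_poly_similar[of B A, symmetric] unfolding similar_mat_def by blast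
    also have "\<dots> = char_poly B1 * char_poly B4"
      unfolding sb(5) B3 using sb by (intro char_poly_four_block_zeros_col) auto
    also have "char_poly B1 = [:- e, 1:]" by (simp add: B1 char_poly_defs det_def sign_def)
    finally have cp: "char_poly A = [:- e, 1:] * char_poly B4" .
    have "char_poly B4 \<noteq> 0" using degree_monic_char_poly[OF sb(4)] by auto
    then have ras: "root_abs_sum (char_poly A) = \<bar>e\<bar> + root_abs_sum (char_poly B4)"
      unfolding cp by (rule root_abs_sum_linear_times)
    obtain U where U: "U \<in> carrier_mat n n" "U\<^sup>T * U = 1\<^sub>m n"
      and IH: "root_abs_sum (char_poly B4) \<le> (\<Sum>i<n. \<bar>(U\<^sup>T * (B4 * U)) $$ (i, i)\<bar>)"
      using Suc.IH[OF sb(4)] by auto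
    \<comment> \<open>\<open>D\<close> acts on the lower block only and leaves the corner \<open>e\<close> in place.\<close>
    define D where "D = four_block_mat (1\<^sub>m 1) (0\<^sub>m 1 n) (0\<^sub>m n 1) U"
    have D: "D \<in> carrier_mat (Suc n) (Suc n)" using U by (auto simp: D_def)
    have DT: "D\<^sup>T = four_block_mat (1\<^sub>m 1) (0\<^sub>m 1 n) (0\<^sub>m n 1) (U\<^sup>T)"
      unfolding D_def by (subst transpose_four_block_mat) (use U in auto)
    have DTD: "D\<^sup>T * D = 1\<^sub>m (Suc n)"
      unfolding DT unfolding D_def
      by (subst mult_four_block_mat[where ?nr1.0=1 and ?n1.0=1 and ?n2.0=n and ?nr2.0=n and ?nc1.0=1 and ?nc2.0=n]) (use U in auto)
    have DBD: "D\<^sup>T * (B * D) = four_block_mat B1 (B2 * U) (0\<^sub>m n 1) (U\<^sup>T * (B4 * U))"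
      unfolding DT unfolding D_def sb(5) B3
      apply (subst mult_four_block_mat[where ?nr1.0=1 and ?n1.0=1 and ?n2.0=n and ?nr2.0=n and ?nc1.0=1 and ?nc2.0=n])
      using U sb apply auto[8]
      apply (subst mult_four_block_mat[where ?nr1.0=1 and ?n1.0=1 and ?n2.0=n and ?nr2.0=n and ?nc1.0=1 and ?nc2.0=n])
      using U sb by auto
    define Y where "Y = W * D"
    have Y: "Y \<in> carrier_mat (Suc n) (Suc n)" using W D by (simp add: Y_def)
    have YT: "Y\<^sup>T = D\<^sup>T * W\<^sup>T" unfolding Y_def using W D by (simp add: transpose_mult)
    note assoc = assoc_mult_mat[of _ "Suc n" "Suc n" _ "Suc n" _ "Suc n"]
    have "Y\<^sup>T * Y = D\<^sup>T * ((W\<^sup>T * W) * D)"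
      unfolding YT unfolding Y_def
      using assoc_mult_mat[OF _ WT mult_carrier_mat[OF W(1) D], of "D\<^sup>T"] assoc_mult_mat[OF WT W(1) D] D by simp
    also have "\<dots> = 1\<^sub>m (Suc n)" using W(2) D DTD by simp
    finally have YY: "Y\<^sup>T * Y = 1\<^sub>m (Suc n)" .
    have YAY: "Y\<^sup>T * (A * Y) = four_block_mat B1 (B2 * U) (0\<^sub>m n 1) (U\<^sup>T * (B4 * U))"
      unfolding DBD[symmetric] unfolding YT unfolding Y_def B_def using A W D WT by (simp add: assoc)
    have "root_abs_sum (char_poly A) \<le> \<bar>e\<bar> + (\<Sum>i<n. \<bar>(U\<^sup>T * (B4 * U)) $$ (i, i)\<bar>)"
      using ras IH by simp
    also have "\<dots> = (\<Sum>i<Suc n. \<bar>(Y\<^sup>T * (A * Y)) $$ (i, i)\<bar>)"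
      unfolding YAY sum.lessThan_Suc_shift using U sb B1 by simp
    finally show ?thesis using Y YY by auto
  qed
qed

section \<open>Quadratic forms and frames\<close>

text \<open>
  A symmetric idempotent kernel is the Gram matrix of its own columns. The map \<open>g\<close> lets the same fact
  serve for a subset of \<open>V\<close> (with the identity) and for an enumeration of it by indices.
\<close>

lemma gram_kernel_quadratic_form_nonneg:
  fixes E :: "'a \<Rightarrow> 'a \<Rightarrow> real"
  assumes sym: "\<And>u v. E u v = E v u"
    and idem: "\<And>u v. u \<in> V \<Longrightarrow> v \<in> V \<Longrightarrow> (\<Sum>w\<in>V. E u w * E w v) = E u v"
    and g: "g ` I \<subseteq> V"
  shows "(\<Sum>i\<in>I. \<Sum>j\<in>I. x i * x j * E (g i) (g j)) \<ge> 0"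
proof -
  have "(\<Sum>i\<in>I. \<Sum>j\<in>I. x i * x j * E (g i) (g j)) =
        (\<Sum>i\<in>I. \<Sum>j\<in>I. x i * x j * (\<Sum>w\<in>V. E (g i) w * E w (g j)))"
    using g by (intro sum.cong refl) (simp add: idem image_subset_iff)
  also have "\<dots> = (\<Sum>i\<in>I. \<Sum>w\<in>V. \<Sum>j\<in>I. (x i * E (g i) w) * (x j * E (g j) w))"
    unfolding sum_distrib_left
    by (rule sum.cong[OF refl], subst sum.swap) (simp add: sym[of _ "g _"] mult_ac)
  also have "\<dots> = (\<Sum>w\<in>V. (\<Sum>i\<in>I. x i * E (g i) w) * (\<Sum>j\<in>I. x j * E (g j) w))"
    unfolding sum_product by (rule sum.swap)
  also have "\<dots> \<ge> 0" by (intro sum_nonneg) simp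
  finally show ?thesis .
qed

text \<open>
  The vectors \<open>w k\<close> form a Parseval frame: the rank one matrices \<open>w k (w k)\<^sup>T\<close> add up to the identity,
  so the values of a quadratic form on them add up to its trace. Orthonormal bases are the usual
  example; the columns of a pair of complementary orthogonal projections are another.
\<close>

lemma sum_abs_quadratic_form_le_trace:
  fixes a b :: "'i \<Rightarrow> 'i \<Rightarrow> real" and w :: "'k \<Rightarrow> 'i \<Rightarrow> real"
  assumes "finite I"
    and dom: "\<And>k. k \<in> K \<Longrightarrow> \<bar>\<Sum>i\<in>I. \<Sum>j\<in>I. w k i * w k j * a i j\<bar> \<le> (\<Sum>i\<in>I. \<Sum>j\<in>I. w k i * w k j * b i j)"
    and frame: "\<And>i j. i \<in> I \<Longrightarrow> j \<in> I \<Longrightarrow> (\<Sum>k\<in>K. w k i * w k j) = of_bool (i = j)"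
  shows "(\<Sum>k\<in>K. \<bar>\<Sum>i\<in>I. \<Sum>j\<in>I. w k i * w k j * a i j\<bar>) \<le> (\<Sum>i\<in>I. b i i)"
proof -
  have "(\<Sum>k\<in>K. \<bar>\<Sum>i\<in>I. \<Sum>j\<in>I. w k i * w k j * a i j\<bar>) \<le> (\<Sum>k\<in>K. \<Sum>i\<in>I. \<Sum>j\<in>I. w k i * w k j * b i j)"
    by (intro sum_mono dom)
  also have "\<dots> = (\<Sum>i\<in>I. \<Sum>j\<in>I. (\<Sum>k\<in>K. w k i * w k j) * b i j)"
    unfolding sum_distrib_right
    by (subst sum.swap, rule sum.cong[OF refl], subst sum.swap) simp
  also have "\<dots> = (\<Sum>i\<in>I. \<Sum>j\<in>I. if j = i then b i j else 0)"
    by (intro sum.cong refl) (auto simp: frame)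
  also have "\<dots> = (\<Sum>i\<in>I. b i i)" using \<open>finite I\<close> by simp
  finally show ?thesis .
qed

section \<open>Spectral projections of a strongly regular graph\<close>

text \<open>
  The adjacency matrix \<open>a\<close> of a strongly regular graph, as a real function of two vertices: the
  square of \<open>a\<close> is a combination of \<open>a\<close>, the identity and the all-ones matrix. The parameters are
  real numbers so that their differences are not truncated.
\<close>

locale srg_kernel =
  fixes V :: "'a set" and a :: "'a \<Rightarrow> 'a \<Rightarrow> real" and d l m :: real
  assumes finite_V [simp]: "finite V" and nonempty_V: "V \<noteq> {}"
    and a_sym: "a u v = a v u"
    and a_diag [simp]: "a u u = 0"
    and row_sum: "u \<in> V \<Longrightarrow> (\<Sum>w\<in>V. a u w) = d"
    and square: "u \<in> V \<Longrightarrow> v \<in> V \<Longrightarrow>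
      (\<Sum>w\<in>V. a u w * a w v) = m + (l - m) * a u v + (d - m) * of_bool (u = v)"
    and m_nonneg: "0 \<le> m" and m_le_d: "m \<le> d" and l_nonneg: "0 \<le> l" and l_less_d: "l < d"
begin

text \<open>
  The eigenvalues of \<open>a\<close> are the degree \<open>d\<close>, on constant vectors, and the two roots \<open>r\<close> and \<open>s\<close> of
  \<open>x\<^sup>2 - (l - m) x - (d - m)\<close> on vectors with sum zero; \<open>t\<close> is the difference of these roots.
\<close>

definition "n = real (card V)"
definition "t = sqrt ((l - m)\<^sup>2 + 4 * (d - m))"
definition "r = (l - m + t) / 2"
definition "s = (l - m - t) / 2"

lemma n_pos: "n > 0" and d_pos: "d > 0"
  using nonempty_V l_less_d l_nonneg by (auto simp: n_def card_gt_0_iff)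

lemma t_square: "t\<^sup>2 = (l - m)\<^sup>2 + 4 * (d - m)"
  using m_le_d by (simp add: t_def)

lemma r_plus_s: "r + s = l - m" and r_minus_s: "r - s = t"
  by (simp_all add: r_def s_def field_simps)

lemma r_times_s: "r * s = m - d"
proof -
  have "r * s = ((l - m)\<^sup>2 - t\<^sup>2) / 4" by (simp add: r_def s_def power2_eq_square field_simps)
  then show ?thesis by (simp add: t_square)
qed

lemma t_ge: "\<bar>l - m\<bar> \<le> t"
  unfolding t_def using m_le_d by (intro real_le_rsqrt) simp

lemma r_nonneg: "r \<ge> 0" using t_ge by (simp add: r_def)

text \<open>
  If \<open>m < d\<close>, the product \<open>r s = m - d\<close> is negative. If \<open>m = d\<close>, one root is zero and the other is \<open>l - m\<close>,
  which is negative because \<open>l < d\<close>.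
\<close>

lemma s_neg: "s < 0"
proof -
  have "l - m < t"
  proof (cases "m = d")
    case True then show ?thesis using t_ge l_less_d by linarith
  next
    case False
    then have "\<bar>l - m\<bar> < t"
      unfolding t_def using m_le_d by (intro real_less_rsqrt) auto
    then show ?thesis by linarith
  qed
  then show ?thesis by (simp add: s_def)
qed

lemma t_pos: "t > 0" using r_nonneg s_neg r_minus_s by linarith

text \<open>
  Apply the quadratic equation for \<open>a\<close> to the all-ones vector, that is, count the walks of length two
  that start at a vertex.
\<close>

lemma d_minus_r_times_d_minus_s: "(d - r) * (d - s) = n * m"
proof -
  obtain u where u: "u \<in> V" using nonempty_V by auto
  have "(\<Sum>w\<in>V. a u w * (\<Sum>v\<in>V. a w v)) = (\<Sum>v\<in>V. \<Sum>w\<in>V. a u w * a w v)"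
    unfolding sum_distrib_left by (rule sum.swap)
  also have "\<dots> = (\<Sum>v\<in>V. m + (l - m) * a u v + (if v = u then d - m else 0))"
    by (intro sum.cong refl) (auto simp: square u)
  also have "\<dots> = n * m + (l - m) * d + (d - m)"
    using u by (simp add: sum.distrib row_sum n_def flip: sum_distrib_left)
  also have "(\<Sum>w\<in>V. a u w * (\<Sum>v\<in>V. a w v)) = d * d"
    using u by (simp add: row_sum flip: sum_distrib_right)
  finally have "d * d = n * m + (r + s) * d - r * s" by (simp add: r_plus_s r_times_s)
  then show ?thesis by (simp add: algebra_simps)
qed

lemma r_le_d: "r \<le> d"
proof -
  have "d - s > 0" using s_neg d_pos by linarith
  moreover have "(d - r) * (d - s) \<ge> 0"
    unfolding d_minus_r_times_d_minus_s using n_pos m_nonneg by simp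
  ultimately show ?thesis by (simp add: zero_le_mult_iff)
qed

text \<open>
  Combinations of \<open>a\<close>, the identity and the all-ones matrix are closed under multiplication.
\<close>

lemma kernel_product:
  assumes "u \<in> V" "v \<in> V"
  shows "(\<Sum>w\<in>V. (\<alpha> * a u w + \<beta> * of_bool (u = w) + \<gamma>) * (\<alpha>' * a w v + \<beta>' * of_bool (w = v) + \<gamma>')) =
    (\<alpha> * \<alpha>' * (l - m) + \<alpha> * \<beta>' + \<beta> * \<alpha>') * a u v + (\<alpha> * \<alpha>' * (d - m) + \<beta> * \<beta>') * of_bool (u = v)
    + (\<alpha> * \<alpha>' * m + (\<alpha> * \<gamma>' + \<gamma> * \<alpha>') * d + \<beta> * \<gamma>' + \<gamma> * \<beta>' + n * \<gamma> * \<gamma>')"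
proof -
  have "(\<Sum>w\<in>V. (\<alpha> * a u w + \<beta> * of_bool (u = w) + \<gamma>) * (\<alpha>' * a w v + \<beta>' * of_bool (w = v) + \<gamma>')) =
    (\<Sum>w\<in>V. \<alpha> * \<alpha>' * (a u w * a w v) + \<alpha> * \<gamma>' * a u w + \<gamma> * \<alpha>' * a v w + \<gamma> * \<gamma>'
      + (if w = u then \<beta> * (\<alpha>' * a u v + \<beta>' * of_bool (u = v) + \<gamma>') else 0)
      + (if w = v then \<beta>' * (\<alpha> * a u v + \<gamma>) else 0))"
    by (intro sum.cong refl) (auto simp: algebra_simps a_sym[of _ v])
  also have "\<dots> = \<alpha> * \<alpha>' * (m + (l - m) * a u v + (d - m) * of_bool (u = v)) + \<alpha> * \<gamma>' * d + \<gamma> * \<alpha>' * d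
      + n * \<gamma> * \<gamma>' + \<beta> * (\<alpha>' * a u v + \<beta>' * of_bool (u = v) + \<gamma>') + \<beta>' * (\<alpha> * a u v + \<gamma>)"
    using assms by (simp add: sum.distrib square row_sum n_def flip: sum_distrib_left)
  finally show ?thesis by (simp add: algebra_simps)
qed

text \<open>
  The orthogonal projections onto the eigenspaces of \<open>r\<close> and \<open>s\<close>, as polynomials in \<open>a\<close> corrected by a
  multiple of the all-ones matrix so that they vanish on constant vectors.
\<close>

definition "proj_r u v = (a u v - s * of_bool (u = v) - (d - s) / n) / t"
definition "proj_s u v = (r * of_bool (u = v) - a u v + (d - r) / n) / t"

lemma proj_sym: "proj_r u v = proj_r v u" "proj_s u v = proj_s v u"
  by (auto simp: proj_r_def proj_s_def a_sym[of u v])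

lemma spectral_decomposition: "a u v = d / n + r * proj_r u v + s * proj_s u v"
  and resolution_of_identity: "of_bool (u = v) = 1 / n + proj_r u v + proj_s u v"
proof -
  have r: "r = s + t" using r_minus_s by simp
  have "x = d / n + r * ((x - s * y - (d - s) / n) / t) + s * ((r * y - x + (d - r) / n) / t)"
    and "y = 1 / n + (x - s * y - (d - s) / n) / t + (r * y - x + (d - r) / n) / t" for x y :: real
    unfolding r using t_pos n_pos by (simp_all add: field_simps)
  then show "a u v = d / n + r * proj_r u v + s * proj_s u v"
    and "of_bool (u = v) = 1 / n + proj_r u v + proj_s u v"
    unfolding proj_r_def proj_s_def by blast+
qed

lemma proj_row_sum:
  assumes "u \<in> V"
  shows "(\<Sum>w\<in>V. proj_r u w) = 0" "(\<Sum>w\<in>V. proj_s u w) = 0"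
proof -
  have "(\<Sum>w\<in>V. proj_r u w) = (\<Sum>w\<in>V. a u w - (if w = u then s else 0) - (d - s) / n) / t"
    unfolding proj_r_def sum_divide_distrib by (intro sum.cong refl) auto
  also have "\<dots> = 0"
    using assms nonempty_V by (simp add: sum_subtractf row_sum n_def)
  finally show "(\<Sum>w\<in>V. proj_r u w) = 0" .
  have "(\<Sum>w\<in>V. proj_s u w) = (\<Sum>w\<in>V. (if w = u then r else 0) - a u w + (d - r) / n) / t"
    unfolding proj_s_def sum_divide_distrib by (intro sum.cong refl) auto
  also have "\<dots> = 0"
    using assms nonempty_V by (simp add: sum_subtractf sum.distrib row_sum n_def)
  finally show "(\<Sum>w\<in>V. proj_s u w) = 0" .
qed

lemma proj_r_idempotent:
  assumes "u \<in> V" "v \<in> V"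
  shows "(\<Sum>w\<in>V. proj_r u w * proj_r w v) = proj_r u v"
proof -
  define c where "c = (d - s) / n"
  have nc: "n * c = d - s" using n_pos by (simp add: c_def)
  have r: "r = s + t" using r_minus_s by simp
  have "m = (d - r) * c" using d_minus_r_times_d_minus_s n_pos by (simp add: c_def field_simps)
  then have m: "m - 2 * c * d + 2 * s * c + (n * c) * c = - t * c"
    unfolding nc r by (simp add: algebra_simps)
  have lm: "l - m = 2 * s + t" and dm: "d - m = - (s * (s + t))"
    using r_plus_s r_times_s unfolding r by (simp_all add: mult.commute)
  have K: "proj_r x y = (1 * a x y + (- s) * of_bool (x = y) + (- c)) / t" for x y
    by (simp add: proj_r_def c_def)
  have "(\<Sum>w\<in>V. (1 * a u w + (- s) * of_bool (u = w) + (- c)) * (1 * a w v + (- s) * of_bool (w = v) + (- c)))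
      = t * (1 * a u v + (- s) * of_bool (u = v) + (- c))"
    unfolding kernel_product[OF assms] lm dm using m by (simp add: algebra_simps)
  then have "(\<Sum>w\<in>V. proj_r u w * proj_r w v) = t * (1 * a u v + (- s) * of_bool (u = v) + (- c)) / (t * t)"
    unfolding K by (simp only: times_divide_times_eq sum_divide_distrib[symmetric])
  then show ?thesis unfolding K using t_pos by simp
qed

lemma proj_r_times_proj_s:
  assumes "u \<in> V" "v \<in> V"
  shows "(\<Sum>w\<in>V. proj_r u w * proj_s w v) = 0"
proof -
  have s: "proj_s w v = of_bool (w = v) - 1 / n - proj_r w v" for w
    using resolution_of_identity[of w v] by simp
  have "(\<Sum>w\<in>V. proj_r u w * proj_s w v) =
      (\<Sum>w\<in>V. (if w = v then proj_r u w else 0) - proj_r u w / n - proj_r u w * proj_r w v)"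
    unfolding s by (intro sum.cong refl) (auto simp: algebra_simps)
  also have "\<dots> = 0"
    using assms by (simp add: sum_subtractf proj_r_idempotent proj_row_sum flip: sum_divide_distrib)
  finally show ?thesis .
qed

lemma proj_s_idempotent:
  assumes "u \<in> V" "v \<in> V"
  shows "(\<Sum>w\<in>V. proj_s u w * proj_s w v) = proj_s u v"
proof -
  have s: "proj_s u w = of_bool (u = w) - 1 / n - proj_r u w" for w
    using resolution_of_identity[of u w] by simp
  have "(\<Sum>w\<in>V. proj_s u w * proj_s w v) =
      (\<Sum>w\<in>V. (if w = u then proj_s w v else 0) - proj_s v w / n - proj_r u w * proj_s w v)"
    unfolding s by (intro sum.cong refl) (auto simp: algebra_simps proj_sym(2)[of _ v])
  also have "\<dots> = proj_s u v"
    using assms by (simp add: sum_subtractf proj_r_times_proj_s proj_row_sum flip: sum_divide_distrib)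
  finally show ?thesis .
qed

lemma adjacency_times_proj_s:
  assumes "u \<in> V" "v \<in> V"
  shows "(\<Sum>w\<in>V. a u w * proj_s w v) = s * proj_s u v"
proof -
  have "(\<Sum>w\<in>V. a u w * proj_s w v) =
      (\<Sum>w\<in>V. d / n * proj_s v w + r * (proj_r u w * proj_s w v) + s * (proj_s u w * proj_s w v))"
    by (intro sum.cong refl)
      (simp add: spectral_decomposition[of u] proj_sym(2)[of _ v] algebra_simps)
  also have "\<dots> = s * proj_s u v"
    using assms
    by (simp add: sum.distrib proj_r_times_proj_s proj_s_idempotent proj_row_sum
        flip: sum_distrib_left sum_divide_distrib)
  finally show ?thesis .
qed

lemma proj_s_diag: "proj_s u u = (r + (d - r) / n) / t" by (simp add: proj_s_def)

text \<open>
  The multiplicity of \<open>s\<close> is positive: all diagonal entries of the projection are equal, so each is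
  that multiplicity divided by \<open>n\<close>.
\<close>

lemma proj_s_diag_pos: "proj_s u u > 0"
proof (cases "r = 0")
  case True then show ?thesis using d_pos n_pos t_pos by (simp add: proj_s_diag)
next
  case False then show ?thesis using r_nonneg r_le_d n_pos t_pos by (simp add: proj_s_diag add_pos_nonneg)
qed

text \<open>
  This is the absolute value of the matrix \<open>a\<close>: since \<open>d\<close> and \<open>r\<close> are nonnegative and \<open>s\<close> is negative,
  only the sign of the \<open>s\<close> part has to be changed.
\<close>

definition "abs_kernel u v = a u v - 2 * s * proj_s u v"

text \<open>
  Both \<open>abs_kernel + a\<close> and \<open>abs_kernel - a\<close> are nonnegative combinations of the three projections.
\<close>

lemma abs_quadratic_form_le:
  assumes "g ` I \<subseteq> V"
  shows "\<bar>\<Sum>i\<in>I. \<Sum>j\<in>I. x i * x j * a (g i) (g j)\<bar> \<le> (\<Sum>i\<in>I. \<Sum>j\<in>I. x i * x j * abs_kernel (g i) (g j))"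
proof -
  let ?q = "\<lambda>K. \<Sum>i\<in>I. \<Sum>j\<in>I. x i * x j * K (g i) (g j)"
  have r0: "?q proj_r \<ge> 0" and s0: "?q proj_s \<ge> 0"
    using assms by (auto intro!: gram_kernel_quadratic_form_nonneg[where V = V] proj_sym proj_r_idempotent proj_s_idempotent)
  have j0: "(\<Sum>i\<in>I. \<Sum>j\<in>I. x i * x j) \<ge> 0" by (simp flip: sum_product)
  have qa: "?q a = d / n * (\<Sum>i\<in>I. \<Sum>j\<in>I. x i * x j) + r * ?q proj_r + s * ?q proj_s"
    by (simp add: spectral_decomposition ring_distribs sum.distrib sum_distrib_left mult_ac)
  have qabs: "?q abs_kernel = ?q a - 2 * s * ?q proj_s"
    by (simp add: abs_kernel_def ring_distribs sum_subtractf sum_distrib_left mult_ac)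
  have "?q a - s * ?q proj_s \<ge> 0"
    unfolding qa using r0 j0 d_pos n_pos r_nonneg by simp
  moreover have "- (s * ?q proj_s) \<ge> 0" using s0 s_neg by (simp add: mult_nonpos_nonneg)
  ultimately show ?thesis unfolding qabs abs_le_iff by linarith
qed

text \<open>
  The common value of the diagonal entries of \<open>abs_kernel\<close>. The trace of \<open>abs_kernel\<close> is the energy,
  so this is the energy per vertex.
\<close>

definition "mean_energy = - 2 * s * (r + (d - r) / n) / t"

lemma abs_kernel_diag: "abs_kernel u u = mean_energy"
  by (simp add: abs_kernel_def mean_energy_def proj_s_diag)

lemma mean_energy_pos: "mean_energy > 0"
proof -
  have "mean_energy = - (2 * s) * proj_s u u" for u by (simp add: mean_energy_def proj_s_diag)
  then show ?thesis using proj_s_diag_pos s_neg by (metis mult_pos_pos mult_neg_pos neg_0_less_iff_less zero_less_numeral mult.commute)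
qed

text \<open>
  The left-hand side is \<open>- 2 s (n r + d - r) / t\<close>. This equals \<open>2 d (n - d + r) / t\<close> because of
  \<open>(d - r) (d - s) = n m\<close> and \<open>m = d + r s\<close>.
\<close>

lemma energy_formula: "n * mean_energy = d * (1 + (2 * (n - d) + l - m) / t)"
proof -
  have "n * (d + r * s) = (d - r) * (d - s)" unfolding d_minus_r_times_d_minus_s r_times_s by simp
  then have "- s * (n * r + (d - r)) = d * (n - d + r)" by (simp add: algebra_simps)
  moreover have "n * (r + (d - r) / n) = n * r + (d - r)"
    using n_pos by (simp add: distrib_left)
  moreover have "n * mean_energy = 2 * (- s * (n * (r + (d - r) / n))) / t"
    unfolding mean_energy_def by simp
  moreover have "d * (1 + (2 * (n - d) + l - m) / t) = 2 * (d * (n - d + r)) / t"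
  proof -
    have e: "2 * (n - d) + l - m = 2 * (n - d + r) - t" using r_plus_s r_minus_s by simp
    show ?thesis unfolding e using t_pos by (simp add: diff_divide_distrib)
  qed
  ultimately show ?thesis by simp
qed

lemma sum_abs_frame_le:
  assumes "finite I" "g ` I \<subseteq> V"
    and "\<And>i j. i \<in> I \<Longrightarrow> j \<in> I \<Longrightarrow> (\<Sum>k\<in>K. w k i * w k j) = of_bool (i = j)"
  shows "(\<Sum>k\<in>K. \<bar>\<Sum>i\<in>I. \<Sum>j\<in>I. w k i * w k j * a (g i) (g j)\<bar>) \<le> real (card I) * mean_energy"
  using sum_abs_quadratic_form_le_trace[of I K w "\<lambda>i j. a (g i) (g j)" "\<lambda>i j. abs_kernel (g i) (g j)"]
    assms abs_quadratic_form_le[OF assms(2)] by (simp add: abs_kernel_diag)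

text \<open>
  The kernel of this form is \<open>t\<close> times the projection onto the eigenspace of \<open>r\<close>.
\<close>

lemma shifted_quadratic_form_nonneg:
  assumes "g ` I \<subseteq> V"
  shows "(\<Sum>i\<in>I. \<Sum>j\<in>I. x i * x j * (a (g i) (g j) - s * of_bool (g i = g j) - (d - s) / n)) \<ge> 0"
proof -
  have "(\<Sum>i\<in>I. \<Sum>j\<in>I. x i * x j * (a (g i) (g j) - s * of_bool (g i = g j) - (d - s) / n)) =
     t * (\<Sum>i\<in>I. \<Sum>j\<in>I. x i * x j * proj_r (g i) (g j))"
    unfolding sum_distrib_left using t_pos by (intro sum.cong refl) (simp add: proj_r_def)
  moreover have "(\<Sum>i\<in>I. \<Sum>j\<in>I. x i * x j * proj_r (g i) (g j)) \<ge> 0"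
    using assms by (auto intro!: gram_kernel_quadratic_form_nonneg[where V = V] proj_sym proj_r_idempotent proj_s_idempotent)
  ultimately show ?thesis using t_pos by simp
qed

text \<open>
  The positive square root of \<open>1 - a / s\<close>, a positive semidefinite matrix with unit diagonal whose
  entries vanish at distinct nonadjacent vertices. Its columns are therefore an orthonormal
  representation of the graph.
\<close>

definition "sqrt_kernel u v = (sqrt (d - s) / n + sqrt t * proj_r u v) / sqrt (- s)"

lemma sqrt_kernel_gram:
  assumes "u \<in> V" "v \<in> V"
  shows "(\<Sum>w\<in>V. sqrt_kernel w u * sqrt_kernel w v) = of_bool (u = v) - a u v / s"
proof -
  have pos: "d - s > 0" "- s > 0" using s_neg d_pos by auto
  have sq: "sqrt (d - s) * sqrt (d - s) = d - s" "sqrt t * sqrt t = t" "sqrt (- s) * sqrt (- s) = - s"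
    using pos t_pos by auto
  have "(\<Sum>w\<in>V. sqrt_kernel w u * sqrt_kernel w v) =
     (\<Sum>w\<in>V. (sqrt (d - s) * sqrt (d - s)) / n / n + sqrt (d - s) * sqrt t / n * proj_r u w
        + sqrt (d - s) * sqrt t / n * proj_r v w + (sqrt t * sqrt t) * (proj_r u w * proj_r w v)) / (sqrt (- s) * sqrt (- s))"
    unfolding sum_divide_distrib
    by (intro sum.cong refl) (simp add: sqrt_kernel_def proj_sym[of _ u] proj_sym[of _ v] add_divide_distrib ring_distribs mult_ac)
  also have "\<dots> = ((d - s) / n + t * proj_r u v) / (- s)"
    unfolding sq using assms nonempty_V
    by (simp add: sum.distrib proj_row_sum proj_r_idempotent n_def
        flip: sum_distrib_left sum_divide_distrib)
  also have "t * proj_r u v = a u v - s * of_bool (u = v) - (d - s) / n"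
    using t_pos by (simp add: proj_r_def)
  also have "((d - s) / n + (a u v - s * of_bool (u = v) - (d - s) / n)) / (- s) = of_bool (u = v) - a u v / s"
    using s_neg by (simp add: diff_divide_distrib)
  finally show ?thesis .
qed

text \<open>
  All column sums coincide, so every column has the same inner product with the normalized all-ones
  vector; that vector is the handle used in the bound for \<open>lovasz_theta\<close>.
\<close>

lemma sqrt_kernel_col_sum:
  assumes "u \<in> V"
  shows "(\<Sum>w\<in>V. sqrt_kernel w u) = sqrt ((d - s) / (- s))"
proof -
  have "(\<Sum>w\<in>V. sqrt_kernel w u) = (\<Sum>w\<in>V. sqrt (d - s) / n + sqrt t * proj_r u w) / sqrt (- s)"
    by (simp add: sqrt_kernel_def proj_sym[of _ u] sum_divide_distrib)
  also have "\<dots> = sqrt (d - s) / sqrt (- s)"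
    using assms nonempty_V by (simp add: sum.distrib proj_row_sum n_def flip: sum_distrib_left)
  finally show ?thesis by (simp only: real_sqrt_divide)
qed

text \<open>
  On the columns of the projection \<open>E\<close> onto the eigenspace of \<open>s\<close> the form of \<open>a\<close> takes the diagonal
  values of \<open>E a E = s E\<close>, and on those of \<open>1 - E\<close> the diagonal values of \<open>(1 - E) a (1 - E) = a - s E\<close>.
  As \<open>a\<close> has zero diagonal, the two differ only in sign.
\<close>

lemma proj_s_column_form:
  assumes "c \<in> V"
  shows "(\<Sum>i\<in>V. \<Sum>j\<in>V. proj_s c i * proj_s c j * a i j) = s * proj_s c c"
proof -
  have "(\<Sum>i\<in>V. \<Sum>j\<in>V. proj_s c i * proj_s c j * a i j) =
      (\<Sum>i\<in>V. proj_s c i * (\<Sum>j\<in>V. a i j * proj_s j c))"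
    unfolding sum_distrib_left by (intro sum.cong refl) (simp add: proj_sym(2)[of c] mult_ac)
  also have "\<dots> = s * (\<Sum>i\<in>V. proj_s c i * proj_s i c)"
    using assms by (simp add: adjacency_times_proj_s sum_distrib_left mult_ac)
  finally show ?thesis using assms by (simp add: proj_s_idempotent)
qed

lemma complementary_column_form:
  assumes "c \<in> V"
  shows "(\<Sum>i\<in>V. \<Sum>j\<in>V. (of_bool (c = i) - proj_s c i) * (of_bool (c = j) - proj_s c j) * a i j) =
    - (s * proj_s c c)"
proof -
  have one: "(\<Sum>j\<in>V. a c j * proj_s c j) = s * proj_s c c"
  proof -
    have "(\<Sum>j\<in>V. a c j * proj_s c j) = (\<Sum>j\<in>V. a c j * proj_s j c)"
      by (rule sum.cong[OF refl]) (simp only: proj_sym(2)[of c])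
    then show ?thesis using assms by (simp add: adjacency_times_proj_s)
  qed
  then have two: "(\<Sum>i\<in>V. a i c * proj_s c i) = s * proj_s c c"
    by (simp only: a_sym[of _ c])
  have "(\<Sum>i\<in>V. \<Sum>j\<in>V. (of_bool (c = i) - proj_s c i) * (of_bool (c = j) - proj_s c j) * a i j) =
      (\<Sum>i\<in>V. \<Sum>j\<in>V. proj_s c i * proj_s c j * a i j - (if j = c then a i c * proj_s c i else 0)
          - (if i = c then a c j * proj_s c j else 0))"
    by (intro sum.cong refl) (auto simp: algebra_simps)
  also have "\<dots> = s * proj_s c c - (\<Sum>i\<in>V. a i c * proj_s c i) - (\<Sum>j\<in>V. a c j * proj_s c j)"
  proof -
    have "(\<Sum>i\<in>V. \<Sum>j\<in>V. if i = c then a c j * proj_s c j else 0) = (\<Sum>j\<in>V. a c j * proj_s c j)"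
      using assms by (subst sum.swap) simp
    then show ?thesis using assms by (simp add: sum_subtractf proj_s_column_form)
  qed
  finally show ?thesis unfolding one two by simp
qed

lemma t_shift: "t + m - l = 2 * (- s)" "2 * d + t + m - l = 2 * (d - s)"
  by (simp_all add: s_def field_simps)

lemma theta_formula: "n * (t + m - l) / (2 * d + t + m - l) = n * (- s) / (d - s)"
  unfolding t_shift mult.left_commute[of n 2] mult_divide_mult_cancel_left_if by simp

lemma total_energy_formula:
  "n * mean_energy = d * (t + 2 * (n - d) + l - m) / t"
  using energy_formula t_pos by (simp add: field_simps)

end

section \<open>Strongly regular induced subgraphs\<close>

text \<open>
  A strongly regular graph inside another one, as an induced subgraph. The two functions \<open>a\<close> and \<open>a'\<close>
  need to agree on the smaller vertex set only.
\<close>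

locale srg_subkernel =
  G: srg_kernel V a d l m + H: srg_kernel V' a' d' l' m'
  for V :: "'a set" and a d l m and V' :: "'a set" and a' d' l' m' +
  assumes V'_subset: "V' \<subseteq> V"
    and a'_eq: "u \<in> V' \<Longrightarrow> v \<in> V' \<Longrightarrow> a' u v = a u v"
begin

text \<open>
  Interlacing: an eigenvector of the smaller graph for its least eigenvalue, extended by zero, is a
  test vector for the larger one. A column of the projection is such an eigenvector; its entries
  add up to zero, so the all-ones part of the form does not contribute.
\<close>

lemma least_eigenvalue_mono: "G.s \<le> H.s"
proof -
  obtain c where c: "c \<in> V'" using H.nonempty_V by auto
  let ?p = "H.proj_s c"
  have "0 \<le> (\<Sum>i\<in>V'. \<Sum>j\<in>V'. ?p i * ?p j * (a (id i) (id j) - G.s * of_bool (id i = id j) - (d - G.s) / G.n))"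
    using V'_subset by (intro G.shifted_quadratic_form_nonneg) simp
  also have "\<dots> = (\<Sum>i\<in>V'. \<Sum>j\<in>V'. ?p i * ?p j * a' i j - (if j = i then G.s * (?p i * H.proj_s i c) else 0)
       - (d - G.s) / G.n * (?p i * ?p j))"
    by (intro sum.cong refl) (auto simp: a'_eq algebra_simps H.proj_sym(2)[of c])
  also have "\<dots> = H.s * ?p c - G.s * ?p c - (d - G.s) / G.n * ((\<Sum>i\<in>V'. ?p i) * (\<Sum>j\<in>V'. ?p j))"
  proof -
    have "(\<Sum>i\<in>V'. \<Sum>j\<in>V'. if j = i then G.s * (?p i * H.proj_s i c) else 0) = G.s * ?p c"
      using c by (simp add: H.proj_s_idempotent flip: sum_distrib_left)
    moreover have "(\<Sum>i\<in>V'. \<Sum>j\<in>V'. (d - G.s) / G.n * (?p i * ?p j)) =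
        (d - G.s) / G.n * ((\<Sum>i\<in>V'. ?p i) * (\<Sum>j\<in>V'. ?p j))"
      unfolding sum_product by (simp only: sum_distrib_left)
    ultimately show ?thesis using c by (simp only: sum_subtractf H.proj_s_column_form)
  qed
  finally have "0 \<le> (H.s - G.s) * ?p c" using c by (simp add: H.proj_row_sum algebra_simps)
  then show ?thesis using H.proj_s_diag_pos[of c] by (simp add: zero_le_mult_iff)
qed

text \<open>
  The two sides are the values of the theta function. The indicator vector of \<open>V'\<close> as a test vector
  bounds its size, giving the inequality with \<open>G.s\<close> on both sides. The left-hand side is increasing
  in \<open>- H.s\<close>, and this is at most \<open>- G.s\<close> by interlacing.
\<close>

lemma ratio_bound: "H.n * (- H.s) / (d' - H.s) \<le> G.n * (- G.s) / (d - G.s)"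
proof -
  have "0 \<le> (\<Sum>i\<in>V'. \<Sum>j\<in>V'. 1 * 1 * (a (id i) (id j) - G.s * of_bool (id i = id j) - (d - G.s) / G.n))"
    using V'_subset by (intro G.shifted_quadratic_form_nonneg) simp
  also have "\<dots> = (\<Sum>i\<in>V'. \<Sum>j\<in>V'. a' i j - (if j = i then G.s else 0) - (d - G.s) / G.n)"
    by (intro sum.cong refl) (auto simp: a'_eq)
  also have "\<dots> = H.n * (d' - G.s - H.n * (d - G.s) / G.n)"
    by (simp add: sum_subtractf sum.distrib H.row_sum H.n_def[symmetric] algebra_simps)
  finally have "H.n * (d - G.s) / G.n \<le> d' - G.s"
    using H.n_pos by (simp add: zero_le_mult_iff)
  then have "H.n * (d - G.s) \<le> G.n * (d' - G.s)"
    using G.n_pos by (simp add: pos_divide_le_eq mult.commute)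
  moreover have pos: "d - G.s > 0" "d' - G.s > 0" "d' - H.s > 0"
    using G.s_neg H.s_neg G.d_pos H.d_pos by auto
  ultimately have *: "H.n / (d' - G.s) \<le> G.n / (d - G.s)" by (simp add: field_simps)
  have "- H.s / (d' - H.s) \<le> - G.s / (d' - G.s)"
  proof -
    have "- H.s * (d' - G.s) \<le> - G.s * (d' - H.s)"
      using least_eigenvalue_mono H.d_pos by (simp add: algebra_simps)
    then show ?thesis using pos by (simp add: divide_simps)
  qed
  then have "H.n * (- H.s / (d' - H.s)) \<le> H.n * (- G.s / (d' - G.s))"
    using H.n_pos by (intro mult_left_mono) auto
  also have "\<dots> = - G.s * (H.n / (d' - G.s))" by simp
  also have "\<dots> \<le> - G.s * (G.n / (d - G.s))"
    using * G.s_neg by (intro mult_left_mono) auto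
  finally show ?thesis by (simp add: mult_ac)
qed

text \<open>
  Take the columns of \<open>E\<close> and of \<open>1 - E\<close> as a frame, where \<open>E\<close> is the projection onto the least
  eigenspace of the smaller graph. The absolute values of the form of \<open>a'\<close> on this frame add up to
  exactly the energy of the smaller graph, while the larger graph bounds that sum by \<open>card V'\<close> times
  its own energy per vertex.
\<close>

lemma mean_energy_mono: "H.mean_energy \<le> G.mean_energy"
proof -
  define w where "w = case_sum H.proj_s (\<lambda>c i. of_bool (c = i) - H.proj_s c i)"
  have frame: "(\<Sum>k\<in>V' <+> V'. w k i * w k j) = of_bool (i = j)" if "i \<in> V'" "j \<in> V'" for i j
  proof -
    have "(\<Sum>k\<in>V' <+> V'. w k i * w k j) = (\<Sum>c\<in>V'. 2 * (H.proj_s i c * H.proj_s c j)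
       + (if c = i then of_bool (i = j) - H.proj_s i j else 0) - (if c = j then H.proj_s i j else 0))"
      by (subst sum.Plus)
        (auto simp: w_def sum.distrib[symmetric] H.proj_sym(2)[of _ i] algebra_simps intro!: sum.cong)
    also have "\<dots> = of_bool (i = j)"
      using that by (simp add: sum.distrib sum_subtractf H.proj_s_idempotent flip: sum_distrib_left)
    finally show ?thesis .
  qed
  have "(\<Sum>k\<in>V' <+> V'. \<bar>\<Sum>i\<in>V'. \<Sum>j\<in>V'. w k i * w k j * a (id i) (id j)\<bar>) \<le> real (card V') * G.mean_energy"
    using V'_subset frame by (intro G.sum_abs_frame_le) auto
  moreover have "(\<Sum>k\<in>V' <+> V'. \<bar>\<Sum>i\<in>V'. \<Sum>j\<in>V'. w k i * w k j * a (id i) (id j)\<bar>) =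
      (\<Sum>k\<in>V' <+> V'. \<bar>\<Sum>i\<in>V'. \<Sum>j\<in>V'. w k i * w k j * a' i j\<bar>)"
    by (intro sum.cong refl arg_cong[where f = abs]) (simp add: a'_eq)
  moreover have "\<dots> = (\<Sum>c\<in>V'. H.mean_energy)"
  proof -
    have column: "\<bar>H.s * H.proj_s c c\<bar> = H.mean_energy / 2" for c
    proof -
      have "H.mean_energy = - 2 * (H.s * H.proj_s c c)"
        by (simp add: H.mean_energy_def H.proj_s_diag)
      moreover have "H.s * H.proj_s c c < 0" using H.s_neg H.proj_s_diag_pos by (rule mult_neg_pos)
      ultimately show ?thesis by simp
    qed
    show ?thesis
      by (simp add: column sum.Plus w_def o_def H.proj_s_column_form H.complementary_column_form)
  qed
  ultimately show ?thesis using H.n_pos by (simp add: H.n_def)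
qed

lemma theta_ratio_le_1:
  "H.n / G.n * ((H.t + m' - l') / (G.t + m - l)) * ((2 * d + G.t + m - l) / (2 * d' + H.t + m' - l')) \<le> 1"
proof -
  have pos: "G.n * (- G.s) / (d - G.s) > 0"
    using G.n_pos G.s_neg G.d_pos by (intro divide_pos_pos mult_pos_pos) auto
  have "H.n / G.n * ((H.t + m' - l') / (G.t + m - l)) * ((2 * d + G.t + m - l) / (2 * d' + H.t + m' - l')) =
      (H.n * (- H.s) / (d' - H.s)) / (G.n * (- G.s) / (d - G.s))"
    unfolding G.t_shift H.t_shift mult_divide_mult_cancel_left_if by simp
  also have "\<dots> \<le> 1" using ratio_bound pos by (simp only: divide_le_eq_1_pos)
  finally show ?thesis .
qed

lemma energy_ratio_le_1:
  "G.t * d' / (H.t * d) * ((H.t + 2 * (H.n - d') + l' - m') / (G.t + 2 * (G.n - d) + l - m)) \<le> 1"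
proof -
  have "G.t * d' / (H.t * d) * ((H.t + 2 * (H.n - d') + l' - m') / (G.t + 2 * (G.n - d) + l - m)) =
      (H.n * H.mean_energy) / (G.n * G.mean_energy)"
    unfolding G.total_energy_formula H.total_energy_formula by (simp add: mult_ac)
  also have "H.n * H.mean_energy \<le> G.n * G.mean_energy"
    using card_mono[OF _ V'_subset] mean_energy_mono H.mean_energy_pos
    by (intro mult_mono) (auto simp: G.n_def H.n_def)
  then have "(H.n * H.mean_energy) / (G.n * G.mean_energy) \<le> 1"
    using G.n_pos G.mean_energy_pos by (simp only: divide_le_eq_1_pos mult_pos_pos)
  finally show ?thesis .
qed

end

section \<open>Induced subgraphs of strongly regular graphs: theta function and energy\<close>

definition adj :: "('a, 'b) pre_digraph \<Rightarrow> 'a \<Rightarrow> 'a \<Rightarrow> real" where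
  "adj G u v = of_bool (u \<rightarrow>\<^bsub>G\<^esub> v)"

lemma (in graph) out_degree_eq_card_neighbors: "out_degree G u = card {w \<in> verts G. u \<rightarrow>\<^bsub>G\<^esub> w}"
proof -
  have "inj_on (head G) (out_arcs G u)"
    using no_multi_arcs by (auto simp: inj_on_def out_arcs_def arc_to_ends_def)
  moreover have "head G ` out_arcs G u = {w \<in> verts G. u \<rightarrow>\<^bsub>G\<^esub> w}"
    by (auto simp: out_arcs_def arcs_ends_conv)
  ultimately show ?thesis unfolding out_degree_def by (metis card_image)
qed

text \<open>
  Strict inequality \<open>l < d\<close> holds because the head of an arc is a neighbor of its tail but not a common
  neighbor of both. The bound \<open>m \<le> d\<close> needs a pair of distinct nonadjacent vertices, which exists
  because the graph is not complete.
\<close>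

lemma strongly_regular_imp_srg_kernel:
  assumes "strongly_regular G n d l m"
  shows "srg_kernel (verts G) (adj G) (real d) (real l) (real m)"
proof -
  interpret graph G using assms by (simp add: strongly_regular_def)
  let ?N = "\<lambda>u. {w \<in> verts G. u \<rightarrow>\<^bsub>G\<^esub> w}"
  have deg: "card (?N u) = d" if "u \<in> verts G" for u
    using assms that out_degree_eq_card_neighbors[of u] by (simp add: strongly_regular_def)
  have adjacent: "card (common_neighbors G u v) = l" if "u \<in> verts G" "v \<in> verts G" "u \<rightarrow>\<^bsub>G\<^esub> v" for u v
    using assms that by (simp add: strongly_regular_def)
  have nonadjacent: "card (common_neighbors G u v) = m"
    if "u \<in> verts G" "v \<in> verts G" "u \<noteq> v" "\<not> u \<rightarrow>\<^bsub>G\<^esub> v" for u v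
    using assms that by (simp add: strongly_regular_def)
  have sym: "v \<rightarrow>\<^bsub>G\<^esub> u" if "u \<rightarrow>\<^bsub>G\<^esub> v" for u v
    using that sym_arcs by (simp add: symmetric_def sym_def)
  have irrefl: "\<not> u \<rightarrow>\<^bsub>G\<^esub> u" for u
    using no_loops by (auto simp: arcs_ends_conv)
  have common_sub: "common_neighbors G u v \<subseteq> ?N u" for u v by (auto simp: common_neighbors_def)
  obtain e where e: "e \<in> arcs G" using assms by (auto simp: strongly_regular_def)
  define x y where "x = tail G e" and "y = head G e"
  have xy: "x \<in> verts G" "y \<in> verts G" "x \<rightarrow>\<^bsub>G\<^esub> y"
    using e by (auto simp: x_def y_def arcs_ends_conv)
  have "common_neighbors G x y \<subset> ?N x"
    using xy irrefl by (auto simp: common_neighbors_def)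
  then have "card (common_neighbors G x y) < card (?N x)" by (intro psubset_card_mono) auto
  then have l_less: "l < d" using deg[OF xy(1)] adjacent[OF xy] by simp
  have "arcs_ends G \<noteq> {(u, v). (u, v) \<in> verts G \<times> verts G \<and> u \<noteq> v}"
    using assms by (auto simp: strongly_regular_def complete_digraph_def)
  moreover have "arcs_ends G \<subseteq> {(u, v). (u, v) \<in> verts G \<times> verts G \<and> u \<noteq> v}"
    using no_loops by (auto simp: arcs_ends_conv)
  ultimately obtain u v where uv: "u \<in> verts G" "v \<in> verts G" "u \<noteq> v" "\<not> u \<rightarrow>\<^bsub>G\<^esub> v" by auto
  then have m_le: "m \<le> d" using card_mono[OF _ common_sub[of u v]] deg[OF uv(1)] nonadjacent[OF uv] by simp
  show ?thesis
  proof
    show "adj G u v = adj G v u" for u v using sym by (auto simp: adj_def)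
    show "adj G u u = 0" for u using irrefl by (simp add: adj_def)
    show "(\<Sum>w\<in>verts G. adj G u w) = real d" if "u \<in> verts G" for u
      using deg[OF that] by (simp add: adj_def of_bool_def sum.If_cases Int_def)
    show "(\<Sum>w\<in>verts G. adj G u w * adj G w v) =
        real m + (real l - real m) * adj G u v + (real d - real m) * of_bool (u = v)"
      if uv: "u \<in> verts G" "v \<in> verts G" for u v
    proof -
      have "(\<Sum>w\<in>verts G. adj G u w * adj G w v) = (\<Sum>w\<in>verts G. of_bool (u \<rightarrow>\<^bsub>G\<^esub> w \<and> v \<rightarrow>\<^bsub>G\<^esub> w))"
        using sym by (intro sum.cong) (auto simp: adj_def)
      also have "\<dots> = real (card (common_neighbors G u v))"
        by (simp add: common_neighbors_def of_bool_def sum.If_cases Int_def)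
      also have "\<dots> = real m + (real l - real m) * adj G u v + (real d - real m) * of_bool (u = v)"
      proof (cases "u = v")
        case True
        then have "common_neighbors G u v = ?N u" by (auto simp: common_neighbors_def)
        then show ?thesis using True deg[OF uv(1)] irrefl by (simp add: adj_def)
      next
        case False
        then show ?thesis using adjacent[OF uv] nonadjacent[OF uv] by (simp add: adj_def)
      qed
      finally show ?thesis .
    qed
  qed (use xy m_le l_less in auto)
qed

lemma dominates_induced_subgraph_iff:
  assumes "induced_subgraph H G" "u \<in> verts H" "v \<in> verts H"
  shows "u \<rightarrow>\<^bsub>H\<^esub> v \<longleftrightarrow> u \<rightarrow>\<^bsub>G\<^esub> v"
  using assms by (auto simp: induced_subgraph_def subgraph_def compatible_def arcs_ends_conv)

lemma set_vertex_list:
  assumes "finite (verts H)"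
  shows "distinct (vertex_list H)" "set (vertex_list H) = verts H"
proof -
  have "distinct (vertex_list H) \<and> set (vertex_list H) = verts H"
    unfolding vertex_list_def by (rule someI_ex) (use finite_distinct_list[OF assms] in blast)
  then show "distinct (vertex_list H)" "set (vertex_list H) = verts H" by auto
qed

lemma energy_eq_root_abs_sum: "energy H = root_abs_sum (char_poly (adjacency_matrix H))"
proof -
  have "adjacency_matrix H \<in> carrier_mat (length (vertex_list H)) (length (vertex_list H))"
    by (simp add: adjacency_matrix_def Let_def)
  from eigenvalue_root_char_poly[OF this] show ?thesis
    unfolding energy_def root_abs_sum_def by (intro sum.cong) auto
qed

text \<open>
  The columns of the orthogonal matrix that triangularizes the adjacency matrix of \<open>H\<close>, indexed
  through the vertex list, form the frame to which \<open>sum_abs_frame_le\<close> is applied.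
\<close>

lemma (in srg_kernel) energy_le_card_mean_energy:
  assumes sub: "verts H \<subseteq> V"
    and agree: "\<And>u v. u \<in> verts H \<Longrightarrow> v \<in> verts H \<Longrightarrow> adj H u v = a u v"
  shows "energy H \<le> real (card (verts H)) * mean_energy"
proof -
  define vs where "vs = vertex_list H"
  define N where "N = length vs"
  define A where "A = adjacency_matrix H"
  have fin: "finite (verts H)" using sub finite_V by (rule finite_subset)
  note vs = set_vertex_list[OF fin, folded vs_def]
  have N: "N = card (verts H)" using vs distinct_card[of vs] by (simp add: N_def)
  have nth: "vs ! i \<in> verts H" if "i < N" for i using that nth_mem[of i vs] vs(2) unfolding N_def by simp
  have A: "A \<in> carrier_mat N N" by (simp add: A_def adjacency_matrix_def Let_def N_def vs_def)
  have A_index: "A $$ (i, j) = a (vs ! i) (vs ! j)" if "i < N" "j < N" for i j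
    using that agree[OF nth nth, of i j]
    by (auto simp: A_def adjacency_matrix_def Let_def N_def vs_def adj_def)
  obtain W where W: "W \<in> carrier_mat N N" "W\<^sup>T * W = 1\<^sub>m N"
    and le: "root_abs_sum (char_poly A) \<le> (\<Sum>k<N. \<bar>(W\<^sup>T * (A * W)) $$ (k, k)\<bar>)"
    using root_abs_sum_char_poly_le[OF A] by blast
  define w where "w k i = W $$ (i, k)" for k i
  have WWT: "W * W\<^sup>T = 1\<^sub>m N" using mat_mult_left_right_inverse[of "W\<^sup>T" N W] W by simp
  have frame: "(\<Sum>k<N. w k i * w k j) = of_bool (i = j)" if "i < N" "j < N" for i j
  proof -
    have "(\<Sum>k<N. w k i * w k j) = (W * W\<^sup>T) $$ (i, j)"
      using that W(1) by (simp add: scalar_prod_def w_def lessThan_atLeast0)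
    then show ?thesis using that by (simp add: WWT)
  qed
  have "(W\<^sup>T * (A * W)) $$ (k, k) = (\<Sum>i<N. \<Sum>j<N. w k i * w k j * a (vs ! i) (vs ! j))" if "k < N" for k
    using that W(1) A
    by (simp add: scalar_prod_def w_def lessThan_atLeast0 A_index sum_distrib_left mult_ac)
  then have "energy H \<le> (\<Sum>k<N. \<bar>\<Sum>i<N. \<Sum>j<N. w k i * w k j * a (vs ! i) (vs ! j)\<bar>)"
    using le by (simp add: energy_eq_root_abs_sum A_def)
  also have "\<dots> \<le> real (card {..<N}) * mean_energy"
    using frame sub nth by (intro sum_abs_frame_le) auto
  finally show ?thesis by (simp add: N)
qed

text \<open>
  The columns of \<open>sqrt_kernel\<close> that belong to vertices of \<open>H\<close> represent \<open>H\<close>, because vertices that are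
  nonadjacent in \<open>H\<close> are nonadjacent in the larger graph. With the constant handle all vertices attain
  the same value, so the maximum is that value.
\<close>

lemma (in srg_kernel) lovasz_theta_le:
  assumes sub: "verts H \<subseteq> V" and ne: "verts H \<noteq> {}"
    and agree: "\<And>u v. u \<in> verts H \<Longrightarrow> v \<in> verts H \<Longrightarrow> adj H u v = a u v"
  shows "lovasz_theta H \<le> ereal (n * (- s) / (d - s))"
proof -
  obtain xs where xs: "distinct xs" "set xs = V" using finite_distinct_list[OF finite_V] by blast
  define k where "k = length xs"
  have bij: "bij_betw (nth xs) {0..<k} V"
    using bij_betw_nth[OF xs(1)] xs(2) by (simp add: k_def lessThan_atLeast0)
  have k: "real k = n" using xs distinct_card[of xs] by (simp add: k_def n_def)
  define u where "u v = vec k (\<lambda>i. sqrt_kernel (xs ! i) v)" for v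
  define c where "c = vec k (\<lambda>_. 1 / sqrt n)"
  have uu: "u v \<bullet> u w = of_bool (v = w) - a v w / s" if "v \<in> verts H" "w \<in> verts H" for v w
  proof -
    have "u v \<bullet> u w = (\<Sum>i\<in>{0..<k}. sqrt_kernel (xs ! i) v * sqrt_kernel (xs ! i) w)"
      by (simp add: u_def scalar_prod_def)
    also have "\<dots> = (\<Sum>x\<in>V. sqrt_kernel x v * sqrt_kernel x w)"
      by (rule sum.reindex_bij_betw[OF bij])
    finally show ?thesis using that sub by (simp add: sqrt_kernel_gram subset_iff)
  qed
  have rep: "orthonormal_rep H k u"
    unfolding orthonormal_rep_def
  proof (intro conjI ballI impI)
    fix i assume "i \<in> verts H"
    then show "u i \<bullet> u i = 1" by (simp add: uu)
    show "u i \<in> carrier_vec k" by (simp add: u_def)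
  next
    fix i j assume "i \<in> verts H" "j \<in> verts H" "i \<noteq> j \<and> \<not> i \<rightarrow>\<^bsub>H\<^esub> j"
    then show "u i \<bullet> u j = 0" using agree[of i j] by (simp add: uu adj_def)
  qed
  have cc: "c \<bullet> c = 1" using n_pos k by (simp add: c_def scalar_prod_def)
  have cu: "1 / ereal ((c \<bullet> u v)\<^sup>2) = ereal (n * (- s) / (d - s))" if "v \<in> verts H" for v
  proof -
    have "c \<bullet> u v = (\<Sum>i\<in>{0..<k}. sqrt_kernel (xs ! i) v) / sqrt n"
      by (simp add: u_def c_def scalar_prod_def sum_divide_distrib)
    also have "(\<Sum>i\<in>{0..<k}. sqrt_kernel (xs ! i) v) = (\<Sum>x\<in>V. sqrt_kernel x v)"
      by (rule sum.reindex_bij_betw[OF bij])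
    also have "\<dots> = sqrt ((d - s) / (- s))" using that sub by (intro sqrt_kernel_col_sum) auto
    finally have "c \<bullet> u v = sqrt ((d - s) / (- s)) / sqrt n" .
    moreover have "(d - s) / (- s) > 0" using s_neg d_pos by (intro divide_pos_pos) auto
    ultimately have "(c \<bullet> u v)\<^sup>2 = (d - s) / (- s) / n"
      using n_pos by (simp only: power_divide real_sqrt_pow2 less_imp_le)
    moreover have "(d - s) / (- s) / n \<noteq> 0" using s_neg d_pos n_pos by simp
    ultimately have "1 / ereal ((c \<bullet> u v)\<^sup>2) = ereal (1 / ((d - s) / (- s) / n))"
      by (simp only: one_ereal_def ereal_divide) simp
    then show ?thesis by simp
  qed
  have "(\<lambda>v. 1 / ereal ((c \<bullet> u v)\<^sup>2)) ` verts H = {ereal (n * (- s) / (d - s))}"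
    using cu ne by auto
  then have "Max ((\<lambda>v. 1 / ereal ((c \<bullet> u v)\<^sup>2)) ` verts H) = ereal (n * (- s) / (d - s))" by simp
  then show ?thesis
    unfolding lovasz_theta_def using rep cc
    by (intro Inf_lower) (auto simp: c_def intro!: exI[of _ k] exI[of _ u] exI[of _ c])
qed

theorem corollary5p1:
  fixes G H :: "('a, 'b) pre_digraph"
    and n d l m :: nat
    and t :: real
  assumes "strongly_regular G n d l m"
    and "induced_subgraph H G" and "verts H \<noteq> {}"
    and "t = sqrt ((real l - real m)\<^sup>2 + 4 * (real d - real m))"
  shows "(lovasz_theta H \<le> ereal (real n * (t + real m - real l) / (2 * real d + t + real m - real l)) \<and>
          energy H \<le> real d * (1 + (2 * (real n - real d) + real l - real m) / t)) \<and>
         (\<forall>n' d' l' m' :: nat. \<forall>t' :: real.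
            strongly_regular H n' d' l' m' \<and> n' \<le> n \<and> d' \<le> d \<and> l' \<le> l \<and> m' \<le> m \<and>
            t' = sqrt ((real l' - real m')\<^sup>2 + 4 * (real d' - real m')) \<longrightarrow>
            real n' / real n * ((t' + real m' - real l') / (t + real m - real l)) *
              ((2 * real d + t + real m - real l) / (2 * real d' + t' + real m' - real l')) \<le> 1 \<and>
            t * real d' / (t' * real d) *
              ((t' + 2 * (real n' - real d') + real l' - real m') /
               (t + 2 * (real n - real d) + real l - real m)) \<le> 1)"
proof -
  interpret G: srg_kernel "verts G" "adj G" "real d" "real l" "real m"
    using strongly_regular_imp_srg_kernel[OF assms(1)] .
  have n: "G.n = real n" using assms(1) by (simp add: G.n_def strongly_regular_def)
  have t: "G.t = t" using assms(4) by (simp add: G.t_def)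
  have sub: "verts H \<subseteq> verts G" using assms(2) by (auto simp: induced_subgraph_def subgraph_def)
  have agree: "adj H u v = adj G u v" if "u \<in> verts H" "v \<in> verts H" for u v
    using dominates_induced_subgraph_iff[OF assms(2) that] by (simp add: adj_def)
  have theta_value: "real n * (t + real m - real l) / (2 * real d + t + real m - real l) = G.n * (- G.s) / (real d - G.s)"
    using G.theta_formula by (simp only: n t)
  have energy_value: "real d * (1 + (2 * (real n - real d) + real l - real m) / t) = G.n * G.mean_energy"
    using G.energy_formula by (simp only: n t)
  have "lovasz_theta H \<le> ereal (real n * (t + real m - real l) / (2 * real d + t + real m - real l))"
    unfolding theta_value using sub assms(3) agree by (rule G.lovasz_theta_le)
  moreover have "energy H \<le> real d * (1 + (2 * (real n - real d) + real l - real m) / t)"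
  proof -
    have "energy H \<le> real (card (verts H)) * G.mean_energy"
      using sub agree by (rule G.energy_le_card_mean_energy)
    also have "\<dots> \<le> G.n * G.mean_energy"
      using card_mono[OF _ sub] G.mean_energy_pos by (intro mult_right_mono) (auto simp: G.n_def)
    finally show ?thesis unfolding energy_value .
  qed
  moreover have "real n' / real n * ((t' + real m' - real l') / (t + real m - real l)) *
              ((2 * real d + t + real m - real l) / (2 * real d' + t' + real m' - real l')) \<le> 1 \<and>
            t * real d' / (t' * real d) *
              ((t' + 2 * (real n' - real d') + real l' - real m') /
               (t + 2 * (real n - real d) + real l - real m)) \<le> 1"
    if H: "strongly_regular H n' d' l' m'"
      and t'_def: "t' = sqrt ((real l' - real m')\<^sup>2 + 4 * (real d' - real m'))"
    for n' d' l' m' :: nat and t' :: real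
  proof -
    interpret srg_subkernel "verts G" "adj G" "real d" "real l" "real m"
      "verts H" "adj H" "real d'" "real l'" "real m'"
      using strongly_regular_imp_srg_kernel[OF H] sub agree
      by (intro srg_subkernel.intro srg_subkernel_axioms.intro G.srg_kernel_axioms) auto
    have n': "H.n = real n'" using H by (simp add: H.n_def strongly_regular_def)
    have t': "H.t = t'" using t'_def by (simp add: H.t_def)
    show ?thesis using theta_ratio_le_1 energy_ratio_le_1 by (simp only: n t n' t')
  qed
  ultimately show ?thesis by blast
qed

end
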